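(* Let $m\ge2$ be an integer, let $X=\mathbb R^m$ with its standard inner product and norm, let $\alpha_0,\dots,\alpha_{m-1}$ be nonnegative reals with $\sum_{i=0}^{m-1}\alpha_i=1$, and let $\mathfrak q=\frac12\|\cdot\|^2$. Let $(g_0,\dots,g_{m-1})\in(\Gamma(X))^m$ and define $$(\forall n\ge m)\quad g_n=\big(\alpha_{m-1}(g_{n-1}+\mathfrak q)^*+\cdots+\alpha_0(g_{n-m}+\mathfrak q)^*\big)^*-\mathfrak q .$$ Then the following hold: (i) The sequence $(g_n)_{n\in\mathbb N}$ lies in $\Gamma(X)$. (ii) $(\forall n\ge m)\quad g_n\Box\mathfrak q=\alpha_{m-1}(g_{n-1}\Box\mathfrak q)+\cdots+\alpha_0(g_{n-m}\Box\mathfrak q)$. (iii) Suppose that the Basic Hypothesis (see context) holds. Then $(g_n)_{n\in\mathbb N}$ epi-converges to $$g=\big(\lambda_{m-1}(g_{m-1}+\mathfrak q)^*+\cdots+\lambda_0(g_0+\mathfrak q)^*\big)^*-\mathfrak q,$$ and $(g_n^* )_{n\in\mathbb N}$ epi-converges to $g^*$, where $$g^*=\big(\lambda_{m-1}(g_{m-1}^*+\mathfrak q)^*+\cdots+\lambda_0(g_0^*+\mathfrak q)^*\big)^*-\mathfrak q .$$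
   Context: $\Gamma(X)$ is the set of all functions $X\to\,]-\infty,+\infty]$ that are convex, lower semicontinuous and proper. The Fenchel conjugate of $g$ is $g^*(x)=\sup_{y\in X}(\langle x,y\rangle-g(y))$. The Moreau envelope of $g$ is $(g\Box\mathfrak q)(x)=\inf_{y\in X}\big(g(y)+\frac12\|x-y\|^2\big)$. For $k\in\{0,\dots,m-1\}$: $\lambda_k=\dfrac{\sum_{i=0}^k\alpha_i}{\sum_{j=0}^{m-1}\sum_{i=0}^j\alpha_i}$. Basic Hypothesis: the polynomial $p(x)=x^m-\alpha_{m-1}x^{m-1}-\cdots-\alpha_1x-\alpha_0$ has a unique positive root, which is simple and equal to $1$, and every other (complex) root has modulus strictly less than $1$. Epi-convergence: functions $g_n\colon X\to\,]-\infty,+\infty]$ epi-converge to $g\colon X\to\,]-\infty,+\infty]$ if for every $x\in X$: (a) for every sequence $x_n\to x$, $g(x)\le\liminf_n g_n(x_n)$; and (b) there exists a sequence $y_n\to x$ with $\limsup_n g_n(y_n)\le g(x)$. *)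

theory Defs
  imports "HOL-Analysis.Analysis" "HOL-Computational_Algebra.Polynomial"
begin

definition half_sq :: "'a::real_normed_vector \<Rightarrow> ereal" where
  "half_sq x = ereal (1 / 2 * (norm x)\<^sup>2)"

definition proper_fun :: "('a \<Rightarrow> ereal) \<Rightarrow> bool" where
  "proper_fun f \<longleftrightarrow> (\<forall>x. f x \<noteq> - \<infinity>) \<and> (\<exists>x. f x \<noteq> \<infinity>)"

(* Only used together with proper_fun, so the right-hand side never has the form
   \<infinity> + (- \<infinity>); restricting to 0 < t < 1 avoids the product 0 * \<infinity>. *)
definition convex_fun :: "('a::real_vector \<Rightarrow> ereal) \<Rightarrow> bool" where
  "convex_fun f \<longleftrightarrow>
     (\<forall>x y t. 0 < t \<and> t < 1 \<longrightarrow>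
        f ((1 - t) *\<^sub>R x + t *\<^sub>R y) \<le> ereal (1 - t) * f x + ereal t * f y)"

definition lsc_fun :: "('a::topological_space \<Rightarrow> ereal) \<Rightarrow> bool" where
  "lsc_fun f \<longleftrightarrow> (\<forall>x. f x \<le> Liminf (nhds x) f)"

definition Gamma_fun :: "('a::real_normed_vector \<Rightarrow> ereal) set" where
  "Gamma_fun = {f. convex_fun f \<and> lsc_fun f \<and> proper_fun f}"

definition fenchel_conj :: "('a::real_inner \<Rightarrow> ereal) \<Rightarrow> 'a \<Rightarrow> ereal" where
  "fenchel_conj f x = (SUP y. ereal (x \<bullet> y) - f y)"

definition moreau_env :: "('a::real_normed_vector \<Rightarrow> ereal) \<Rightarrow> 'a \<Rightarrow> ereal" where
  "moreau_env f x = (INF y. f y + half_sq (x - y))"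

(* (w 0 (h 0 + q)^* + ... + w (m-1) (h (m-1) + q)^* )^* - q  with  q = half_sq.
   For h i in Gamma_fun each (h i + q)^* is finite everywhere, so the library
   convention 0 * \<infinity> = 0 plays no role when a weight w i vanishes. *)
definition prox_average ::
  "nat \<Rightarrow> (nat \<Rightarrow> real) \<Rightarrow> (nat \<Rightarrow> 'a::real_inner \<Rightarrow> ereal) \<Rightarrow> 'a \<Rightarrow> ereal" where
  "prox_average m w h x =
     fenchel_conj (\<lambda>u. \<Sum>i<m. ereal (w i) * fenchel_conj (\<lambda>y. h i y + half_sq y) u) x
       - half_sq x"

definition limit_weight :: "nat \<Rightarrow> (nat \<Rightarrow> real) \<Rightarrow> nat \<Rightarrow> real" where
  "limit_weight m \<alpha> k = (\<Sum>i\<le>k. \<alpha> i) / (\<Sum>j<m. \<Sum>i\<le>j. \<alpha> i)"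

definition char_poly :: "nat \<Rightarrow> (nat \<Rightarrow> real) \<Rightarrow> real poly" where
  "char_poly m \<alpha> = monom 1 m - (\<Sum>i<m. monom (\<alpha> i) i)"

definition basic_hypothesis :: "nat \<Rightarrow> (nat \<Rightarrow> real) \<Rightarrow> bool" where
  "basic_hypothesis m \<alpha> \<longleftrightarrow>
     (\<forall>x>0. poly (char_poly m \<alpha>) x = 0 \<longleftrightarrow> x = 1) \<and>
     order 1 (char_poly m \<alpha>) = 1 \<and>
     (\<forall>z::complex. poly (map_poly of_real (char_poly m \<alpha>)) z = 0 \<and> z \<noteq> 1 \<longrightarrow> norm z < 1)"

(* The first two conjuncts say that all functions take values in ]-\<infinity>, +\<infinity>]. *)
definition epi_converges ::
  "(nat \<Rightarrow> 'a::topological_space \<Rightarrow> ereal) \<Rightarrow> ('a \<Rightarrow> ereal) \<Rightarrow> bool" where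
  "epi_converges f g \<longleftrightarrow>
     (\<forall>n x. f n x \<noteq> - \<infinity>) \<and> (\<forall>x. g x \<noteq> - \<infinity>) \<and>
     (\<forall>x. (\<forall>X. X \<longlonglongrightarrow> x \<longrightarrow> g x \<le> liminf (\<lambda>n. f n (X n))) \<and>
          (\<exists>Y. Y \<longlonglongrightarrow> x \<and> limsup (\<lambda>n. f n (Y n)) \<le> g x))"

end

theory Submission
  imports Defs "HOL-Computational_Algebra.Fundamental_Theorem_Algebra"
begin

text \<open>
  The recursion is linear once it is read on Moreau envelopes. Write \<open>q\<close> for half the squared norm
  (\<open>hq\<close> below, real-valued) and let \<open>E = g \<box> q\<close>. For \<open>g\<close> in \<open>\<Gamma>\<close> the function \<open>E\<close> is finite, and both
  \<open>E\<close> and \<open>q - E\<close> are convex (lemma \<open>Gamma_fun_moreau_env\<close>); \<open>q - E\<close> is nothing but \<open>(g + q)\<^sup>*\<close>.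
  The functions with these two properties form the class \<open>env_class\<close>, and the deconvolution
  \<open>deconv E x = sup\<^sub>u (E u - q (x - u))\<close> leads back from \<open>E\<close> to \<open>\<Gamma>\<close>: it is a member of \<open>\<Gamma>\<close> whose
  envelope is \<open>E\<close> (lemmas \<open>deconv_in_Gamma_fun\<close> and \<open>moreau_env_deconv\<close>). Since \<open>deconv E\<close> is also
  \<open>(q - E)\<^sup>* - q\<close>, a proximal average is the deconvolution of the averaged envelopes
  (lemma \<open>prox_average_eq_deconv\<close>). Membership in \<open>\<Gamma>\<close> and the formula for the envelopes follow at
  once, because \<open>env_class\<close> is closed under convex combinations.

  Consequently, for each fixed point \<open>x\<close>, the numbers \<open>E\<^sub>n x\<close> satisfy the scalar recurrence with
  coefficients \<open>\<alpha>\<close>. The characteristic polynomial is \<open>(X - 1) r\<close> with all roots of \<open>r\<close> in the open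
  unit disc, so the sequence converges; the limit is identified by the conserved quantity
  \<open>\<Sum>\<^sub>k (\<alpha>\<^sub>0 + \<dots> + \<alpha>\<^sub>k) E\<^bsub>n+k\<^esub> x\<close> (lemma \<open>recurrence_tendsto\<close>).

  Pointwise convergence of envelopes is then turned into epi-convergence of their deconvolutions
  (lemma \<open>epi_converges_deconv\<close>). The lower bound is immediate from the supremum that defines \<open>deconv\<close>.
  For the recovery sequence one uses that \<open>q - E\<close> is differentiable with a quadratic upper bound, so
  its gradients at a fixed point converge too; the values of \<open>deconv\<close> at such gradients are
  explicit, and every point of the domain is approximated by gradients.

  Finally \<open>E \<mapsto> q - E\<close> is an involution of \<open>env_class\<close> and corresponds to conjugation on \<open>\<Gamma>\<close>
  (lemma \<open>fenchel_conj_eq_deconv\<close>), so the statements on conjugates are the same statements applied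
  to \<open>q - E\<^sub>n\<close>. The only separation arguments in the proof are the subgradients of finite convex
  functions and the affine minorants of members of \<open>\<Gamma>\<close>.
\<close>

section \<open>Half the squared norm, subgradients and affine minorants\<close>

definition hq :: "'a::real_inner \<Rightarrow> real" where
  "hq x = (x \<bullet> x) / 2"

lemma hq_minus [simp]: "hq (- x) = hq x"
  by (simp add: hq_def)

lemma hq_nonneg [simp]: "0 \<le> hq x"
  by (simp add: hq_def)

lemma half_sq_eq: "half_sq x = ereal (hq x)"
  by (simp add: half_sq_def hq_def power2_norm_eq_inner)

lemma hq_diff: "hq (x - y) = hq x - x \<bullet> y + hq y"
  by (simp add: hq_def inner_simps inner_commute field_simps)

lemma hq_add: "hq (x + y) = hq x + x \<bullet> y + hq y"
  by (simp add: hq_def inner_simps inner_commute field_simps)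

lemma inner_le_hq_add: "x \<bullet> y \<le> hq x + hq y"
  using hq_nonneg[of "x - y"] hq_diff[of x y] by linarith

lemma hq_convex_comb:
  "hq ((1 - t) *\<^sub>R x + t *\<^sub>R y) = (1 - t) * hq x + t * hq y - t * (1 - t) * hq (x - y)"
  by (simp add: hq_def inner_simps inner_commute field_simps)

lemma convex_on_UNIV_I:
  assumes "\<And>x y t. 0 < t \<Longrightarrow> t < 1 \<Longrightarrow> f ((1 - t) *\<^sub>R x + t *\<^sub>R y) \<le> (1 - t) * f x + t * f y"
  shows "convex_on UNIV f"
  by (rule convex_onI) (use assms in auto)

text \<open>
  The strict epigraph is convex and misses the point \<open>(x, F x)\<close>, so a hyperplane separates the two.
  It cannot be vertical, since \<open>F\<close> is finite on the whole space.
\<close>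

lemma convex_on_imp_subgradient:
  fixes F :: "'a::euclidean_space \<Rightarrow> real"
  assumes "convex_on UNIV F"
  shows "\<exists>a. \<forall>y. F x + a \<bullet> (y - x) \<le> F y"
proof -
  define S where "S = {z::'a \<times> real. F (fst z) < snd z}"
  have "convex S"
    unfolding convex_alt
  proof (intro ballI allI impI)
    fix p q :: "'a \<times> real" and t :: real
    assume S: "p \<in> S" "q \<in> S" and t: "0 \<le> t \<and> t \<le> 1"
    have "F ((1 - t) *\<^sub>R fst p + t *\<^sub>R fst q) \<le> (1 - t) * F (fst p) + t * F (fst q)"
      using convex_onD[OF assms] t by auto
    also have "\<dots> < (1 - t) * snd p + t * snd q"
    proof (cases "t = 0")
      case False
      with S t show ?thesis
        unfolding S_def by (intro add_le_less_mono mult_left_mono mult_strict_left_mono) auto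
    qed (use S in \<open>auto simp: S_def\<close>)
    finally show "(1 - t) *\<^sub>R p + t *\<^sub>R q \<in> S"
      by (simp add: S_def)
  qed
  moreover have "(0, F 0 + 1) \<in> S"
    by (simp add: S_def)
  then have "S \<noteq> {}" by blast
  moreover have "{(x, F x)} \<inter> S = {}"
    by (auto simp: S_def)
  ultimately obtain c b where c: "c \<noteq> 0" "c \<bullet> (x, F x) \<le> b" "\<forall>z\<in>S. b \<le> c \<bullet> z"
    using separating_hyperplane_sets[of "{(x, F x)}" S] by auto
  obtain c1 c2 where c12: "c = (c1, c2)" by (cases c)
  have sep: "c1 \<bullet> x + c2 * F x \<le> c1 \<bullet> y + c2 * r" if "F y < r" for y r
    using c(2) bspec[OF c(3), of "(y, r)"] that by (auto simp: S_def c12)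
  (* The strict epigraph is unbounded upwards, and a vertical hyperplane (c2 = 0) would have to
     bound a linear functional on the whole space. *)
  have "0 \<le> c2"
    using sep[of x "F x + 1"] by (simp add: algebra_simps)
  moreover have "c2 \<noteq> 0"
  proof
    assume "c2 = 0"
    then have "c1 \<bullet> c1 \<le> 0"
      using sep[of "x - c1" "F (x - c1) + 1"] by (simp add: inner_simps)
    then have "c1 = 0" by (metis inner_ge_zero inner_eq_zero_iff order_antisym)
    with c(1) c12 \<open>c2 = 0\<close> show False by (simp add: zero_prod_def)
  qed
  ultimately have c2: "0 < c2" by simp
  show ?thesis
  proof (intro exI[of _ "- (c1 /\<^sub>R c2)"] allI, rule field_le_epsilon)
    fix y and e :: real assume "0 < e"
    with sep[of y "F y + e"] have "c1 \<bullet> x + c2 * F x \<le> c1 \<bullet> y + c2 * (F y + e)" by simp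
    then have "F x - (c1 \<bullet> y - c1 \<bullet> x) / c2 \<le> F y + e"
      using c2 by (simp add: field_simps)
    then show "F x + - (c1 /\<^sub>R c2) \<bullet> (y - x) \<le> F y + e"
      using c2 by (simp add: inner_simps divide_simps)
  qed
qed

text \<open>
  Lower semicontinuity makes the epigraph closed, so it is strictly separated from a point just below
  the graph over the domain; strictness rules out a vertical hyperplane.
\<close>

lemma Gamma_fun_affine_minorant:
  fixes g :: "'a::euclidean_space \<Rightarrow> ereal"
  assumes "g \<in> Gamma_fun"
  obtains a b where "\<And>y. ereal (a \<bullet> y - b) \<le> g y"
proof -
  from assms have conv: "convex_fun g" and lsc: "lsc_fun g" and proper: "proper_fun g"
    by (auto simp: Gamma_fun_def)
  define S where "S = {z::'a \<times> real. g (fst z) \<le> ereal (snd z)}"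
  from proper obtain x0 r0 where x0: "g x0 = ereal r0"
    unfolding proper_fun_def by (metis ereal_cases)
  have "convex S"
    unfolding convex_alt
  proof (intro ballI allI impI)
    fix p q :: "'a \<times> real" and t :: real
    assume S: "p \<in> S" "q \<in> S" and t: "0 \<le> t \<and> t \<le> 1"
    show "(1 - t) *\<^sub>R p + t *\<^sub>R q \<in> S"
    proof (cases "t = 0 \<or> t = 1")
      case False
      with t have t: "0 < t" "t < 1" by auto
      have "g ((1 - t) *\<^sub>R fst p + t *\<^sub>R fst q) \<le> ereal (1 - t) * g (fst p) + ereal t * g (fst q)"
        using conv t by (auto simp: convex_fun_def)
      also have "\<dots> \<le> ereal (1 - t) * ereal (snd p) + ereal t * ereal (snd q)"
        using S t unfolding S_def by (intro add_mono ereal_mult_left_mono) auto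
      finally show ?thesis by (simp add: S_def)
    qed (use S in auto)
  qed
  moreover have "closed S"
  proof -
    have "open (- S)"
      unfolding open_prod_def
    proof
      fix z assume "z \<in> - S"
      then have "ereal (snd z) < g (fst z)" by (auto simp: S_def)
      then obtain r where r: "snd z < r" "ereal r < g (fst z)"
        using ereal_dense2 by fastforce
      have "ereal r < Liminf (nhds (fst z)) g"
        using lsc r(2) unfolding lsc_fun_def by (meson order_less_le_trans)
      then have "eventually (\<lambda>y. ereal r < g y) (nhds (fst z))"
        by (rule less_LiminfD)
      then obtain U where U: "open U" "fst z \<in> U" "\<forall>y\<in>U. ereal r < g y"
        by (auto simp: eventually_nhds)
      have "U \<times> {..<r} \<subseteq> - S"
      proof
        fix w assume "w \<in> U \<times> {..<r}"
        then have "ereal (snd w) < ereal r" "ereal r < g (fst w)" using U(3) by auto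
        then have "ereal (snd w) < g (fst w)" by (rule less_trans)
        then show "w \<in> - S" by (simp add: S_def)
      qed
      with U r(1) show "\<exists>A B. open A \<and> open B \<and> z \<in> A \<times> B \<and> A \<times> B \<subseteq> - S"
        by (intro exI[of _ U] exI[of _ "{..<r}"]) (auto simp: mem_Times_iff)
    qed
    then show ?thesis by (simp add: closed_def)
  qed
  moreover have "(x0, r0 - 1) \<notin> S" by (auto simp: S_def x0)
  ultimately obtain c b where c: "c \<bullet> (x0, r0 - 1) < b" "\<forall>z\<in>S. b < c \<bullet> z"
    using separating_hyperplane_closed_point[of S "(x0, r0 - 1)"] by blast
  obtain c1 c2 where c12: "c = (c1, c2)" by (cases c)
  have "b < c1 \<bullet> x0 + c2 * r0"
    using bspec[OF c(2), of "(x0, r0)"] by (simp add: S_def x0 c12)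
  with c(1) have c2: "0 < c2"
    by (simp add: c12 algebra_simps)
  show thesis
  proof (rule that[of "- (c1 /\<^sub>R c2)" "- b / c2"])
    fix y
    show "ereal (- (c1 /\<^sub>R c2) \<bullet> y - - b / c2) \<le> g y"
    proof (cases "g y")
      case (real r)
      then have "b < c1 \<bullet> y + c2 * r"
        using bspec[OF c(2), of "(y, r)"] by (simp add: S_def c12)
      with c2 have "b / c2 - (c1 \<bullet> y) / c2 \<le> r"
        by (simp add: field_simps)
      with real c2 show ?thesis by (simp add: divide_inverse mult.commute)
    next
      case MInf
      with proper show ?thesis by (simp add: proper_fun_def)
    qed simp
  qed
qed

section \<open>Moreau envelopes and their deconvolution\<close>

text \<open>
  On a Euclidean space these are exactly the Moreau envelopes of convex, lower semicontinuous,
  proper functions. In this form the class is visibly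
  stable under convex combinations and under \<open>E \<mapsto> hq - E\<close>.
\<close>

definition env_class :: "('a::real_inner \<Rightarrow> real) set" where
  "env_class = {E. convex_on UNIV E \<and> convex_on UNIV (\<lambda>x. hq x - E x)}"

lemma env_class_reflect: "E \<in> env_class \<Longrightarrow> (\<lambda>x. hq x - E x) \<in> env_class"
  by (simp add: env_class_def)

text \<open>
  The infimum in a finite value of an envelope, unfolded into statements about real numbers.
\<close>

lemma moreau_env_realD:
  fixes h :: "'a::real_inner \<Rightarrow> ereal"
  assumes "moreau_env h x = ereal e"
  shows "h y \<noteq> -\<infinity>"
    and "h y = ereal c \<Longrightarrow> e \<le> c + hq (x - y)"
    and "0 < \<epsilon> \<Longrightarrow> \<exists>y c. h y = ereal c \<and> c + hq (x - y) < e + \<epsilon>"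
proof -
  have le: "ereal e \<le> h y + ereal (hq (x - y))" for y
    unfolding assms[symmetric] moreau_env_def half_sq_eq by (rule INF_lower) simp
  from le[of y] show "h y \<noteq> -\<infinity>" by auto
  from le[of y] show "h y = ereal c \<Longrightarrow> e \<le> c + hq (x - y)" by simp
  assume "0 < \<epsilon>"
  then have "moreau_env h x < ereal (e + \<epsilon>)" by (simp add: assms)
  then obtain y where y: "h y + ereal (hq (x - y)) < ereal (e + \<epsilon>)"
    unfolding moreau_env_def half_sq_eq by (auto simp: INF_less_iff)
  with le[of y] show "\<exists>y c. h y = ereal c \<and> c + hq (x - y) < e + \<epsilon>"
    by (cases "h y") auto
qed

text \<open>
  An affine minorant of \<open>g\<close> keeps the infimum above \<open>- \<infinity>\<close>. The envelope is convex as an infimum of a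
  jointly convex function over one of its arguments, and \<open>hq - E\<close> is convex because
  \<open>hq x - (g y + hq (x - y))\<close> is affine in \<open>x\<close>, so that \<open>hq - E\<close> is a supremum of affine functions.
\<close>

lemma Gamma_fun_moreau_env:
  fixes g :: "'a::euclidean_space \<Rightarrow> ereal"
  assumes "g \<in> Gamma_fun"
  obtains E where "E \<in> env_class" "\<And>x. moreau_env g x = ereal (E x)"
proof -
  from assms have conv: "convex_fun g" and proper: "proper_fun g"
    by (auto simp: Gamma_fun_def)
  obtain a b where ab: "\<And>y. ereal (a \<bullet> y - b) \<le> g y"
    using Gamma_fun_affine_minorant[OF assms] by blast
  from proper obtain x0 r0 where x0: "g x0 = ereal r0"
    unfolding proper_fun_def by (metis ereal_cases)
  have fin: "\<bar>moreau_env g x\<bar> \<noteq> \<infinity>" for x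
  proof -
    have "moreau_env g x \<le> g x0 + half_sq (x - x0)"
      unfolding moreau_env_def by (rule INF_lower) simp
    moreover have "ereal (a \<bullet> x - b - hq a) \<le> moreau_env g x"
      unfolding moreau_env_def
    proof (rule INF_greatest)
      fix y
      have "a \<bullet> x - b - hq a \<le> a \<bullet> y - b + hq (x - y)"
        using inner_le_hq_add[of a "x - y"] by (simp add: inner_diff_right)
      then have "ereal (a \<bullet> x - b - hq a) \<le> ereal (a \<bullet> y - b) + half_sq (x - y)"
        by (simp add: half_sq_eq)
      also have "\<dots> \<le> g y + half_sq (x - y)"
        by (intro add_right_mono ab)
      finally show "ereal (a \<bullet> x - b - hq a) \<le> g y + half_sq (x - y)" .
    qed
    ultimately show ?thesis by (auto simp: x0 half_sq_eq)
  qed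
  define E where "E x = real_of_ereal (moreau_env g x)" for x
  have E: "moreau_env g x = ereal (E x)" for x
    unfolding E_def using fin[of x] by (simp add: ereal_real)
  have "convex_on UNIV E"
  proof (rule convex_on_UNIV_I, rule field_le_epsilon)
    fix x y :: 'a and t e :: real assume t: "0 < t" "t < 1" and e: "0 < e"
    obtain u c where u: "g u = ereal c" "c + hq (x - u) < E x + e"
      using moreau_env_realD(3)[OF E e] by blast
    obtain v d where v: "g v = ereal d" "d + hq (y - v) < E y + e"
      using moreau_env_realD(3)[OF E e] by blast
    let ?z = "(1 - t) *\<^sub>R x + t *\<^sub>R y" and ?w = "(1 - t) *\<^sub>R u + t *\<^sub>R v"
    have "g ?w \<le> ereal (1 - t) * g u + ereal t * g v"
      using conv t unfolding convex_fun_def by blast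
    then have gw: "g ?w \<le> ereal ((1 - t) * c + t * d)"
      by (simp add: u v)
    then obtain s where s: "g ?w = ereal s"
      using moreau_env_realD(1)[OF E] by (cases "g ?w") auto
    have eq: "?z - ?w = (1 - t) *\<^sub>R (x - u) + t *\<^sub>R (y - v)"
      by (simp add: algebra_simps)
    have "hq (?z - ?w) \<le> (1 - t) * hq (x - u) + t * hq (y - v)"
      unfolding eq hq_convex_comb using t by simp
    moreover have "E ?z \<le> s + hq (?z - ?w)"
      using moreau_env_realD(2)[OF E s] .
    moreover have "s \<le> (1 - t) * c + t * d" using gw s by simp
    ultimately have "E ?z \<le> (1 - t) * (c + hq (x - u)) + t * (d + hq (y - v))"
      by (simp add: algebra_simps)
    also have "\<dots> \<le> (1 - t) * (E x + e) + t * (E y + e)"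
      by (rule add_mono[OF mult_left_mono mult_left_mono]) (use t u v in auto)
    finally show "E ?z \<le> (1 - t) * E x + t * E y + e"
      by (simp add: algebra_simps)
  qed
  moreover have "convex_on UNIV (\<lambda>x. hq x - E x)"
  proof (rule convex_on_UNIV_I, rule field_le_epsilon)
    fix x y :: 'a and t e :: real assume t: "0 < t" "t < 1" and e: "0 < e"
    let ?z = "(1 - t) *\<^sub>R x + t *\<^sub>R y"
    obtain u c where u: "g u = ereal c" "c + hq (?z - u) < E ?z + e"
      using moreau_env_realD(3)[OF E e] by blast
    (* An affine minorant of hq - E that is exact at ?z up to e. *)
    have le: "v \<bullet> u - hq u - c \<le> hq v - E v" for v
      using moreau_env_realD(2)[OF E u(1), of v] by (simp add: hq_diff)
    have "hq ?z - E ?z \<le> ?z \<bullet> u - hq u - c + e"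
      using u(2) by (simp only: hq_diff)
    also have "\<dots> = (1 - t) * (x \<bullet> u - hq u - c) + t * (y \<bullet> u - hq u - c) + e"
      by (simp add: inner_simps algebra_simps)
    also have "\<dots> \<le> (1 - t) * (hq x - E x) + t * (hq y - E y) + e"
      using t by (intro add_mono mult_left_mono le) auto
    finally show "hq ?z - E ?z \<le> (1 - t) * (hq x - E x) + t * (hq y - E y) + e" .
  qed
  ultimately show thesis
    using E that by (auto simp: env_class_def)
qed

text \<open>
  The deconvolution of \<open>E\<close> by \<open>hq\<close>, the inverse operation to infimal convolution with \<open>hq\<close>.
\<close>

definition deconv :: "('a::real_inner \<Rightarrow> real) \<Rightarrow> 'a \<Rightarrow> ereal" where
  "deconv E x = (SUP u. ereal (E u - hq (x - u)))"

lemma deconv_upper: "ereal (E u - hq (x - u)) \<le> deconv E x"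
  unfolding deconv_def by (rule SUP_upper) simp

text \<open>
  In this form the supremum runs over translates of \<open>E\<close>, so convexity of \<open>E\<close> passes to \<open>deconv E\<close>.
\<close>

lemma deconv_translate: "deconv E x = (SUP v. ereal (E (x + v) - hq v))"
  unfolding deconv_def
proof (rule SUP_eq)
  fix u show "\<exists>v\<in>UNIV. ereal (E u - hq (x - u)) \<le> ereal (E (x + v) - hq v)"
    by (rule bexI[of _ "u - x"]) (auto simp: hq_diff inner_commute)
next
  fix v show "\<exists>u\<in>UNIV. ereal (E (x + v) - hq v) \<le> ereal (E u - hq (x - u))"
    by (rule bexI[of _ "x + v"]) auto
qed

lemma deconv_eq_conj: "deconv E x = fenchel_conj (\<lambda>u. ereal (hq u - E u)) x - half_sq x"
proof -
  have "fenchel_conj (\<lambda>u. ereal (hq u - E u)) x - half_sq x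
      = (SUP u. (ereal (x \<bullet> u) - ereal (hq u - E u)) - half_sq x)"
    unfolding fenchel_conj_def by (rule SUP_ereal_minus_left[symmetric]) (auto simp: half_sq_eq)
  also have "\<dots> = deconv E x"
    unfolding deconv_def by (rule SUP_cong) (auto simp: half_sq_eq hq_diff)
  finally show ?thesis by simp
qed

text \<open>
  The hypothesis says that \<open>y\<close> is a subgradient of \<open>hq - E\<close> at \<open>x\<close>. This is the equality case of the
  Fenchel-Young inequality for \<open>hq - E\<close>: the supremum that defines \<open>deconv E y\<close> is attained at \<open>x\<close>.
\<close>

lemma deconv_eq_of_subgradient:
  assumes "\<And>u. (hq x - E x) + y \<bullet> (u - x) \<le> hq u - E u"
  shows "deconv E y = ereal (E x - hq (y - x))"
proof (rule antisym[OF _ deconv_upper])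
  show "deconv E y \<le> ereal (E x - hq (y - x))"
    unfolding deconv_def
  proof (rule SUP_least)
    fix u
    show "ereal (E u - hq (y - u)) \<le> ereal (E x - hq (y - x))"
      using assms[of u] unfolding hq_diff by (simp add: inner_diff_right)
  qed
qed

text \<open>
  A supremum of translates of the convex function \<open>E\<close> is convex, and a supremum of functions that are
  continuous in \<open>x\<close> is lower semicontinuous. Properness is the point where convexity of \<open>hq - E\<close> enters:
  a subgradient of it is a point where \<open>deconv E\<close> is finite.
\<close>

lemma deconv_in_Gamma_fun:
  fixes E :: "'a::euclidean_space \<Rightarrow> real"
  assumes "E \<in> env_class"
  shows "deconv E \<in> Gamma_fun"
proof -
  have conv: "convex_on UNIV E" and concave: "convex_on UNIV (\<lambda>x. hq x - E x)"
    using assms by (auto simp: env_class_def)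
  obtain a where a: "\<And>u. (hq (0::'a) - E 0) + a \<bullet> (u - 0) \<le> hq u - E u"
    using convex_on_imp_subgradient[OF concave, of 0] by auto
  have "proper_fun (deconv E)"
    unfolding proper_fun_def
  proof (intro conjI allI exI)
    show "deconv E x \<noteq> -\<infinity>" for x
      using deconv_upper[of E x x] by auto
    show "deconv E a \<noteq> \<infinity>"
      unfolding deconv_eq_of_subgradient[OF a] by simp
  qed
  moreover have "convex_fun (deconv E)"
    unfolding convex_fun_def
  proof (intro allI impI)
    fix x y :: 'a and t :: real assume t: "0 < t \<and> t < 1"
    have upper: "ereal (E (x + v) - hq v) \<le> deconv E x" for x v
      unfolding deconv_translate by (rule SUP_upper) simp
    show "deconv E ((1 - t) *\<^sub>R x + t *\<^sub>R y) \<le> ereal (1 - t) * deconv E x + ereal t * deconv E y"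
      unfolding deconv_translate[of E "(1 - t) *\<^sub>R x + t *\<^sub>R y"]
    proof (rule SUP_least)
      fix v
      have "(1 - t) *\<^sub>R x + t *\<^sub>R y + v = (1 - t) *\<^sub>R (x + v) + t *\<^sub>R (y + v)"
        by (simp add: algebra_simps)
      then have "E ((1 - t) *\<^sub>R x + t *\<^sub>R y + v) \<le> (1 - t) * E (x + v) + t * E (y + v)"
        using convex_onD[OF conv, of t "x + v" "y + v"] t by auto
      then have "E ((1 - t) *\<^sub>R x + t *\<^sub>R y + v) - hq v
          \<le> (1 - t) * (E (x + v) - hq v) + t * (E (y + v) - hq v)"
        by (simp add: algebra_simps)
      then have "ereal (E ((1 - t) *\<^sub>R x + t *\<^sub>R y + v) - hq v)
          \<le> ereal (1 - t) * ereal (E (x + v) - hq v) + ereal t * ereal (E (y + v) - hq v)"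
        by simp
      also have "\<dots> \<le> ereal (1 - t) * deconv E x + ereal t * deconv E y"
        using t by (intro add_mono ereal_mult_left_mono upper) auto
      finally show "ereal (E ((1 - t) *\<^sub>R x + t *\<^sub>R y + v) - hq v)
          \<le> ereal (1 - t) * deconv E x + ereal t * deconv E y" .
    qed
  qed
  moreover have "lsc_fun (deconv E)"
    unfolding lsc_fun_def le_Liminf_iff
  proof (intro allI impI)
    fix x :: 'a and r assume "r < deconv E x"
    then obtain u where u: "r < ereal (E u - hq (x - u))"
      unfolding deconv_def by (auto simp: less_SUP_iff)
    have "((\<lambda>y. ereal (E u - hq (y - u))) \<longlongrightarrow> ereal (E u - hq (x - u))) (nhds x)"
      unfolding hq_def by (intro tendsto_intros filterlim_ident) auto
    then have "eventually (\<lambda>y. r < ereal (E u - hq (y - u))) (nhds x)"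
      using u by (auto simp: order_tendsto_iff)
    then show "eventually (\<lambda>y. r < deconv E y) (nhds x)"
      by eventually_elim (use deconv_upper order_less_le_trans in blast)
  qed
  ultimately show ?thesis by (simp add: Gamma_fun_def)
qed

text \<open>
  The infimum is at least \<open>E x\<close> by choosing \<open>u = x\<close> in the supremum, and a subgradient of \<open>hq - E\<close> at \<open>x\<close>
  attains it. This replaces the biconjugate theorem for \<open>hq - E\<close>.
\<close>

lemma moreau_env_deconv:
  fixes E :: "'a::euclidean_space \<Rightarrow> real"
  assumes "E \<in> env_class"
  shows "moreau_env (deconv E) x = ereal (E x)"
proof (rule antisym)
  obtain a where "\<And>u. (hq x - E x) + a \<bullet> (u - x) \<le> hq u - E u"
    using assms convex_on_imp_subgradient[of "\<lambda>x. hq x - E x" x] by (auto simp: env_class_def)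
  then have "deconv E a = ereal (E x - hq (a - x))"
    by (rule deconv_eq_of_subgradient)
  moreover have "moreau_env (deconv E) x \<le> deconv E a + half_sq (x - a)"
    unfolding moreau_env_def by (rule INF_lower) simp
  ultimately show "moreau_env (deconv E) x \<le> ereal (E x)"
    by (simp add: half_sq_eq hq_diff inner_commute)
  show "ereal (E x) \<le> moreau_env (deconv E) x"
    unfolding moreau_env_def
  proof (rule INF_greatest)
    fix y
    have "ereal (E x) = ereal (E x - hq (y - x)) + half_sq (x - y)"
      by (simp add: half_sq_eq hq_diff inner_commute)
    also have "\<dots> \<le> deconv E y + half_sq (x - y)"
      by (intro add_right_mono deconv_upper)
    finally show "ereal (E x) \<le> deconv E y + half_sq (x - y)" .
  qed
qed

text \<open>
  Conjugating \<open>E = h \<box> q\<close> gives \<open>E\<^sup>* = h\<^sup>* + q\<close>, and \<open>E\<^sup>* - q\<close> is the deconvolution of \<open>q - E\<close>. Hence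
  conjugation of \<open>h\<close> amounts to the reflection \<open>E \<mapsto> q - E\<close> of its envelope.
\<close>

lemma fenchel_conj_eq_deconv:
  fixes h :: "'a::real_inner \<Rightarrow> ereal"
  assumes E: "\<And>x. moreau_env h x = ereal (E x)"
  shows "fenchel_conj h = deconv (\<lambda>x. hq x - E x)"
proof (rule ext, rule antisym)
  fix y
  show "fenchel_conj h y \<le> deconv (\<lambda>x. hq x - E x) y"
    unfolding fenchel_conj_def
  proof (rule SUP_least)
    fix v
    show "ereal (y \<bullet> v) - h v \<le> deconv (\<lambda>x. hq x - E x) y"
    proof (cases "h v")
      case (real c)
      have "E (v + y) \<le> c + hq (v + y - v)"
        by (rule moreau_env_realD(2)[OF E real])
      then have "y \<bullet> v - c \<le> hq (v + y) - E (v + y) - hq (y - (v + y))"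
        by (simp add: hq_add inner_commute)
      then have "ereal (y \<bullet> v) - h v \<le> ereal (hq (v + y) - E (v + y) - hq (y - (v + y)))"
        by (simp add: real)
      also have "\<dots> \<le> deconv (\<lambda>x. hq x - E x) y"
        by (rule deconv_upper)
      finally show ?thesis .
    qed (use moreau_env_realD(1)[OF E] in auto)
  qed
  show "deconv (\<lambda>x. hq x - E x) y \<le> fenchel_conj h y"
    unfolding deconv_def
  proof (rule SUP_least, rule ereal_le_epsilon2)
    fix u and e :: real assume "0 < e"
    then obtain v c where v: "h v = ereal c" "c + hq (u - v) < E u + e"
      using moreau_env_realD(3)[OF E] by blast
    have "hq u - hq (u - v) - hq (y - u) \<le> y \<bullet> v"
      using inner_le_hq_add[of "u - y" v] unfolding hq_diff by (simp add: inner_simps inner_commute)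
    with v have "hq u - E u - hq (y - u) \<le> y \<bullet> v - c + e" by linarith
    then have "ereal (hq u - E u - hq (y - u)) \<le> (ereal (y \<bullet> v) - h v) + ereal e"
      by (simp add: v)
    also have "\<dots> \<le> fenchel_conj h y + ereal e"
      unfolding fenchel_conj_def by (intro add_right_mono SUP_upper) simp
    finally show "ereal (hq u - E u - hq (y - u)) \<le> fenchel_conj h y + ereal e" .
  qed
qed

lemma fenchel_conj_add_half_sq:
  fixes h :: "'a::real_inner \<Rightarrow> ereal"
  assumes E: "moreau_env h x = ereal e"
  shows "fenchel_conj (\<lambda>y. h y + half_sq y) x = ereal (hq x - e)"
proof (rule antisym)
  show "fenchel_conj (\<lambda>y. h y + half_sq y) x \<le> ereal (hq x - e)"
    unfolding fenchel_conj_def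
  proof (rule SUP_least)
    fix y
    show "ereal (x \<bullet> y) - (h y + half_sq y) \<le> ereal (hq x - e)"
    proof (cases "h y")
      case (real c)
      from moreau_env_realD(2)[OF E real] show ?thesis
        by (simp add: real half_sq_eq hq_diff)
    qed (use moreau_env_realD(1)[OF E] in auto)
  qed
  show "ereal (hq x - e) \<le> fenchel_conj (\<lambda>y. h y + half_sq y) x"
  proof (rule ereal_le_epsilon2)
    fix \<epsilon> :: real assume "0 < \<epsilon>"
    then obtain v c where v: "h v = ereal c" "c + hq (x - v) < e + \<epsilon>"
      using moreau_env_realD(3)[OF E] by blast
    then have "ereal (hq x - e) \<le> (ereal (x \<bullet> v) - (h v + half_sq v)) + ereal \<epsilon>"
      by (simp add: half_sq_eq hq_diff)
    also have "\<dots> \<le> fenchel_conj (\<lambda>y. h y + half_sq y) x + ereal \<epsilon>"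
      unfolding fenchel_conj_def by (intro add_right_mono SUP_upper) simp
    finally show "ereal (hq x - e) \<le> fenchel_conj (\<lambda>y. h y + half_sq y) x + ereal \<epsilon>" .
  qed
qed

text \<open>
  Each \<open>(h i + q)\<^sup>*\<close> equals \<open>q - E i\<close>, and since the weights sum to one the weighted sum of these is
  \<open>q - \<Sum>\<^sub>i w i E i\<close>, whose conjugate minus \<open>q\<close> is a deconvolution by \<open>deconv_eq_conj\<close>.
\<close>

lemma prox_average_eq_deconv:
  fixes h :: "nat \<Rightarrow> 'a::real_inner \<Rightarrow> ereal"
  assumes E: "\<And>i x. i < m \<Longrightarrow> moreau_env (h i) x = ereal (E i x)"
    and w: "(\<Sum>i<m. w i) = 1"
  shows "prox_average m w h = deconv (\<lambda>x. \<Sum>i<m. w i * E i x)"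
proof
  fix x
  have "(\<Sum>i<m. ereal (w i) * fenchel_conj (\<lambda>y. h i y + half_sq y) u)
      = ereal (hq u - (\<Sum>i<m. w i * E i u))" for u
  proof -
    have "(\<Sum>i<m. ereal (w i) * fenchel_conj (\<lambda>y. h i y + half_sq y) u)
        = (\<Sum>i<m. ereal (w i * (hq u - E i u)))"
      by (intro sum.cong) (auto simp: fenchel_conj_add_half_sq[OF E])
    also have "\<dots> = ereal ((\<Sum>i<m. w i) * hq u - (\<Sum>i<m. w i * E i u))"
      unfolding sum_ereal sum_distrib_right right_diff_distrib sum_subtractf ..
    finally show ?thesis by (simp add: w)
  qed
  then show "prox_average m w h x = deconv (\<lambda>x. \<Sum>i<m. w i * E i x) x"
    unfolding prox_average_def deconv_eq_conj by simp
qed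

lemma env_class_convex_sum:
  fixes E :: "nat \<Rightarrow> 'a::real_inner \<Rightarrow> real"
  assumes E: "\<And>i. i < m \<Longrightarrow> E i \<in> env_class"
    and w: "\<And>i. i < m \<Longrightarrow> 0 \<le> w i" "(\<Sum>i<m. w i) = 1"
  shows "(\<lambda>x. \<Sum>i<m. w i * E i x) \<in> env_class"
proof -
  have sum: "convex_on UNIV (\<lambda>x. \<Sum>i<m. w i * f i x)"
    if "\<And>i. i < m \<Longrightarrow> convex_on UNIV (f i)" for f :: "nat \<Rightarrow> 'a \<Rightarrow> real"
  proof (rule convex_on_UNIV_I)
    fix x y :: 'a and t :: real assume t: "0 < t" "t < 1"
    have "(\<Sum>i<m. w i * f i ((1 - t) *\<^sub>R x + t *\<^sub>R y))
        \<le> (\<Sum>i<m. w i * ((1 - t) * f i x + t * f i y))"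
      using t w(1) convex_onD[OF that] by (intro sum_mono mult_left_mono) auto
    also have "\<dots> = (1 - t) * (\<Sum>i<m. w i * f i x) + t * (\<Sum>i<m. w i * f i y)"
      by (simp add: sum_distrib_left sum.distrib[symmetric] algebra_simps)
    finally show "(\<Sum>i<m. w i * f i ((1 - t) *\<^sub>R x + t *\<^sub>R y))
        \<le> (1 - t) * (\<Sum>i<m. w i * f i x) + t * (\<Sum>i<m. w i * f i y)" .
  qed
  have "(\<Sum>i<m. w i * (hq x - E i x)) = (\<Sum>i<m. w i) * hq x - (\<Sum>i<m. w i * E i x)" for x
    unfolding sum_distrib_right right_diff_distrib sum_subtractf ..
  then have "(\<lambda>x. hq x - (\<Sum>i<m. w i * E i x)) = (\<lambda>x. \<Sum>i<m. w i * (hq x - E i x))"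
    by (simp add: w(2))
  then show ?thesis
    using E sum[of E] sum[of "\<lambda>i x. hq x - E i x"] by (simp add: env_class_def)
qed

section \<open>Epi-convergence of deconvolutions\<close>

text \<open>
  A subgradient \<open>e\<close> of \<open>E\<close> at \<open>u\<close> gives the bound with slope \<open>u - e\<close> instead of \<open>y\<close>. Comparing it with the lower
  bound of slope \<open>y\<close> near \<open>u\<close> forces \<open>y = u - e\<close>; that is, \<open>hq - E\<close> is differentiable.
\<close>

lemma subgradient_quadratic_upper_bound:
  fixes E :: "'a::euclidean_space \<Rightarrow> real"
  assumes E: "E \<in> env_class" and y: "\<And>v. (hq u - E u) + y \<bullet> (v - u) \<le> hq v - E v"
  shows "hq v - E v \<le> (hq u - E u) + y \<bullet> (v - u) + hq (v - u)"
proof -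
  obtain e where e: "\<And>v. E u + e \<bullet> (v - u) \<le> E v"
    using E convex_on_imp_subgradient[of E u] by (auto simp: env_class_def)
  have upper: "hq v - E v \<le> (hq u - E u) + (u - e) \<bullet> (v - u) + hq (v - u)" for v
    using e[of v] by (simp add: hq_diff inner_simps inner_commute) (simp add: hq_def)
  define w where "w = y - (u - e)"
  have "w \<bullet> w = y \<bullet> w - (u - e) \<bullet> w"
    by (metis w_def inner_diff_left)
  then have "w \<bullet> w \<le> hq w"
    using upper[of "u + w"] y[of "u + w"] by simp
  then have "w = 0"
    using inner_ge_zero[of w] by (simp add: hq_def)
  then have "y = u - e" by (simp add: w_def)
  with upper show ?thesis by simp
qed

text \<open>
  A one-sided difference quotient of \<open>hq - E n\<close> in direction \<open>b\<close> bounds \<open>y n \<bullet> b\<close> from above, and in the limit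
  the quadratic upper bound for \<open>hq - E0\<close> makes that quotient exceed \<open>y0 \<bullet> b\<close> by at most \<open>s * hq b\<close>, where
  \<open>s\<close> is the step length. Using \<open>b\<close> and \<open>- b\<close> and letting \<open>s\<close> be small gives convergence.
\<close>

lemma subgradients_tendsto:
  fixes E :: "nat \<Rightarrow> 'a::euclidean_space \<Rightarrow> real"
  assumes lim: "\<And>x. (\<lambda>n. E n x) \<longlonglongrightarrow> E0 x" and E0: "E0 \<in> env_class"
    and y: "\<And>n v. (hq u - E n u) + y n \<bullet> (v - u) \<le> hq v - E n v"
    and y0: "\<And>v. (hq u - E0 u) + y0 \<bullet> (v - u) \<le> hq v - E0 v"
  shows "y \<longlonglongrightarrow> y0"
proof -
  have ev: "eventually (\<lambda>n. (y n - y0) \<bullet> b < e) sequentially" if "0 < e" for b :: 'a and e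
  proof -
    (* The step length is chosen such that s * hq b is at most e / 2. *)
    define s where "s = e / (2 * (hq b + 1))"
    have hb: "0 < hq b + 1" by (simp add: add_nonneg_pos)
    with that have s: "0 < s" unfolding s_def by (intro divide_pos_pos mult_pos_pos) simp_all
    have "s * hq b \<le> e / 2"
      using hb that unfolding s_def by (simp add: divide_le_eq algebra_simps)
    then have sb: "s * hq b * s \<le> e / 2 * s"
      using s by (intro mult_right_mono) auto
    have hs: "hq (s *\<^sub>R b) = s * hq b * s" by (simp add: hq_def)
    let ?F = "\<lambda>E. (hq (u + s *\<^sub>R b) - E (u + s *\<^sub>R b)) - (hq u - E u)"
    have "(\<lambda>n. ?F (E n)) \<longlonglongrightarrow> ?F E0"
      by (intro tendsto_intros lim)
    moreover have "?F E0 < s * (y0 \<bullet> b) + e * s"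
    proof -
      have "?F E0 \<le> s * (y0 \<bullet> b) + hq (s *\<^sub>R b)"
        using subgradient_quadratic_upper_bound[OF E0 y0, of "u + s *\<^sub>R b"] by simp
      also have "\<dots> < s * (y0 \<bullet> b) + e * s"
        using sb mult_pos_pos[OF that s] unfolding hs by linarith
      finally show ?thesis .
    qed
    ultimately have "eventually (\<lambda>n. ?F (E n) < s * (y0 \<bullet> b) + e * s) sequentially"
      by (rule order_tendstoD(2))
    then show ?thesis
    proof eventually_elim
      case (elim n)
      have "s * (y n \<bullet> b) \<le> ?F (E n)"
        using y[of n "u + s *\<^sub>R b"] by simp
      with elim have "s * ((y n - y0) \<bullet> b) < s * e"
        by (simp add: inner_diff_left algebra_simps)
      with s show ?case by simp
    qed
  qed
  have "(\<lambda>n. (y n - y0) \<bullet> b) \<longlonglongrightarrow> 0" for b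
  proof (rule tendstoI)
    fix e :: real assume "0 < e"
    from ev[OF this, of b] ev[OF this, of "- b"]
    show "eventually (\<lambda>n. dist ((y n - y0) \<bullet> b) 0 < e) sequentially"
      by eventually_elim (simp add: abs_less_iff)
  qed
  then have "(\<lambda>n. \<Sum>b\<in>Basis. ((y n - y0) \<bullet> b) *\<^sub>R b) \<longlonglongrightarrow> (\<Sum>b\<in>Basis. 0 *\<^sub>R b)"
    by (intro tendsto_intros)
  then have "(\<lambda>n. y n - y0) \<longlonglongrightarrow> 0"
    by (simp add: euclidean_representation)
  then show ?thesis by (rule LIM_zero_cancel)
qed

text \<open>
  With \<open>F = hq - E\<close>, the function \<open>deconv E + hq\<close> is \<open>F\<^sup>*\<close>. The regularised problem of maximising
  \<open>x \<bullet> u - F u - t * hq u\<close> has a solution \<open>u\<close>, since \<open>x \<bullet> u - F u \<le> F\<^sup>* x < \<infinity>\<close>. Its optimality condition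
  says that \<open>y = x - t u\<close> is a subgradient of \<open>F\<close> at \<open>u\<close>, so that \<open>F\<^sup>* y = y \<bullet> u - F u \<le> F\<^sup>* x\<close>; comparison with the
  value at \<open>0\<close> shows that \<open>t u\<close> has squared norm of order \<open>t\<close>, whence \<open>y\<close> is close to \<open>x\<close> for small \<open>t\<close>.
\<close>

lemma deconv_approx_by_subgradient:
  fixes E :: "'a::euclidean_space \<Rightarrow> real"
  assumes E: "E \<in> env_class" and c: "deconv E x = ereal c" and \<epsilon>: "0 < \<epsilon>"
  shows "\<exists>u y. (\<forall>v. (hq u - E u) + y \<bullet> (v - u) \<le> hq v - E v) \<and>
    dist y x < \<epsilon> \<and> deconv E y \<le> ereal (c + \<epsilon>)"
proof -
  define F where "F v = hq v - E v" for v
  have F: "convex_on UNIV F" using E by (simp add: env_class_def F_def[abs_def])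
  define C where "C = c + hq x"
  have bound: "x \<bullet> v - F v \<le> C" for v
    using deconv_upper[of E v x] by (simp add: c F_def C_def hq_diff)
  define D where "D = C + F 0"
  have D: "0 \<le> D" using bound[of 0] by (simp add: D_def)
  (* Later norm (y - x) < \<delta> by tD, and the factor norm x + 1 keeps hq x - hq y, which is at most
     norm x * norm (y - x), below \<epsilon>. *)
  define \<delta> where "\<delta> = \<epsilon> / (norm x + 1)"
  have \<delta>: "0 < \<delta>" "\<delta> \<le> \<epsilon>" "norm x * \<delta> \<le> \<epsilon>"
    using \<epsilon> by (auto simp: \<delta>_def field_simps add_pos_nonneg)
  define t where "t = \<delta>\<^sup>2 / (2 * D + 1)"
  have t: "0 < t" using \<delta> D by (simp add: t_def)
  have tD: "2 * t * D < \<delta>\<^sup>2"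
    using \<delta> D by (simp add: t_def field_simps)
  define \<phi> where "\<phi> v = x \<bullet> v - F v - t * hq v" for v
  (* Outside the ball of radius R the penalty exceeds D, which makes \<phi> smaller than \<phi> 0. *)
  define R where "R = sqrt (2 * D / t)"
  have "continuous_on (cball 0 R) F"
    using convex_on_continuous[OF open_UNIV F] continuous_on_subset by blast
  then have "continuous_on (cball 0 R) \<phi>"
    unfolding \<phi>_def[abs_def] hq_def by (intro continuous_intros) auto
  moreover have "cball (0::'a) R \<noteq> {}" using D t by (simp add: R_def not_less)
  ultimately obtain u where u: "u \<in> cball 0 R" "\<And>v. v \<in> cball 0 R \<Longrightarrow> \<phi> v \<le> \<phi> u"
    using continuous_attains_sup[OF compact_cball] by blast
  have \<phi>0: "\<phi> 0 \<le> \<phi> u" using D t by (intro u(2)) (simp add: R_def)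
  have max: "\<phi> v \<le> \<phi> u" for v
  proof (cases "v \<in> cball 0 R")
    case False
    then have "R < norm v" by simp
    then have "R\<^sup>2 < (norm v)\<^sup>2"
      using D t by (intro power_strict_mono) (auto simp: R_def)
    then have "D < t * hq v"
      using D t by (simp add: R_def hq_def power2_norm_eq_inner field_simps)
    then have "\<phi> v \<le> \<phi> 0"
      using bound[of v] by (simp add: \<phi>_def D_def hq_def)
    with \<phi>0 show ?thesis by simp
  qed (rule u(2))
  define y where "y = x - t *\<^sub>R u"
  (* First-order optimality: compare \<phi> at u and at u + s (v - u), divide by s and let s tend to 0. *)
  have sub: "F u + y \<bullet> (v - u) \<le> F v" for v
  proof -
    have "eventually (\<lambda>s. y \<bullet> (v - u) - t * s * hq (v - u) \<le> F v - F u) (at_right 0)"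
      unfolding eventually_at_right_field
    proof (intro exI[of _ 1] conjI allI impI)
      fix s :: real assume s: "0 < s" "s < 1"
      define w where "w = u + s *\<^sub>R (v - u)"
      have "w = (1 - s) *\<^sub>R u + s *\<^sub>R v" by (simp add: w_def algebra_simps)
      then have "F w \<le> (1 - s) * F u + s * F v"
        using convex_onD[OF F, of s u v] s by auto
      then have "F w - F u \<le> s * (F v - F u)"
        by (simp add: algebra_simps)
      moreover have "x \<bullet> w - t * hq w = x \<bullet> u - t * hq u + s * (y \<bullet> (v - u) - t * s * hq (v - u))"
      proof -
        have xw: "x \<bullet> w = x \<bullet> u + s * (x \<bullet> (v - u))"
          by (simp add: w_def inner_add_right)
        have hw: "hq w = hq u + s * (u \<bullet> (v - u)) + s * s * hq (v - u)"
          unfolding w_def hq_add by (simp add: hq_def)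
        have yv: "y \<bullet> (v - u) = x \<bullet> (v - u) - t * (u \<bullet> (v - u))"
          by (simp add: y_def inner_diff_left)
        show ?thesis unfolding xw hw yv by algebra
      qed
      moreover have "x \<bullet> w - F w - t * hq w \<le> x \<bullet> u - F u - t * hq u"
        using max[of w] by (simp add: \<phi>_def)
      ultimately have "s * (y \<bullet> (v - u) - t * s * hq (v - u)) \<le> s * (F v - F u)"
        by linarith
      with s show "y \<bullet> (v - u) - t * s * hq (v - u) \<le> F v - F u" by simp
    qed simp
    moreover have "((\<lambda>s. y \<bullet> (v - u) - t * s * hq (v - u)) \<longlongrightarrow> y \<bullet> (v - u) - t * 0 * hq (v - u)) (at_right 0)"
      by (intro tendsto_intros)
    ultimately have "y \<bullet> (v - u) - t * 0 * hq (v - u) \<le> F v - F u"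
      by (intro tendsto_upperbound) auto
    then show ?thesis by simp
  qed
  have "t * hq u \<le> D"
    using \<phi>0 bound[of u] by (simp add: \<phi>_def D_def hq_def)
  then have "2 * t * (t * hq u) \<le> 2 * t * D"
    using t by (intro mult_left_mono) auto
  moreover have "(t * norm u)\<^sup>2 = 2 * t * (t * hq u)"
    unfolding power_mult_distrib power2_norm_eq_inner hq_def by (simp add: power2_eq_square)
  ultimately have "(t * norm u)\<^sup>2 < \<delta>\<^sup>2" using tD by linarith
  then have tu: "t * norm u < \<delta>"
    by (rule power2_less_imp_less) (use \<delta> in simp)
  have "dist y x < \<epsilon>"
    using tu \<delta> t by (simp add: y_def dist_norm)
  moreover have "deconv E y \<le> ereal (c + \<epsilon>)"
  proof -
    have "deconv E y = ereal (E u - hq (y - u))"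
      using sub by (intro deconv_eq_of_subgradient) (simp add: F_def)
    moreover have "E u - hq (y - u) = (x \<bullet> u - F u) - t * (u \<bullet> u) - hq y"
      unfolding hq_diff[of y u] by (simp add: F_def y_def inner_diff_left)
    moreover have "0 \<le> t * (u \<bullet> u)" using t by simp
    moreover have "hq x - hq y \<le> \<epsilon>"
    proof -
      have "hq y = hq x - x \<bullet> (t *\<^sub>R u) + hq (t *\<^sub>R u)"
        unfolding y_def hq_diff ..
      then have "hq x - hq y \<le> x \<bullet> (t *\<^sub>R u)"
        using hq_nonneg[of "t *\<^sub>R u"] by linarith
      also have "\<dots> \<le> norm x * norm (t *\<^sub>R u)" by (rule norm_cauchy_schwarz)
      also have "\<dots> \<le> norm x * \<delta>"
        using tu t by (intro mult_left_mono) auto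
      finally show ?thesis using \<delta> by linarith
    qed
    ultimately show ?thesis using bound[of u] by (simp add: C_def)
  qed
  ultimately show ?thesis
    using sub unfolding F_def by blast
qed

text \<open>
  A diagonal argument: the tolerance at index \<open>n\<close> is the infimum of the admissible ones, increased by a
  null sequence because the infimum itself need not be admissible.
\<close>

lemma shrinking_radius:
  fixes Q :: "nat \<Rightarrow> real \<Rightarrow> bool"
  assumes ev: "\<And>e. 0 < e \<Longrightarrow> eventually (\<lambda>n. Q n e) sequentially"
    and mono: "\<And>n d e. Q n d \<Longrightarrow> d \<le> e \<Longrightarrow> Q n e"
  obtains \<epsilon> where "\<epsilon> \<longlonglongrightarrow> 0" "eventually (\<lambda>n. Q n (\<epsilon> n)) sequentially"
proof
  define A where "A n = {e. 0 < e \<and> Q n e}" for n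
  define \<epsilon> where "\<epsilon> n = Inf (A n) + inverse (real (Suc n))" for n
  have bdd: "bdd_below (A n)" for n
    by (rule bdd_belowI[of _ 0]) (auto simp: A_def)
  show "\<epsilon> \<longlonglongrightarrow> 0"
  proof (rule tendstoI)
    fix e :: real assume e: "0 < e"
    have "eventually (\<lambda>n. inverse (real (Suc n)) < e / 2) sequentially"
      using order_tendstoD(2)[OF LIMSEQ_inverse_real_of_nat, of "e / 2"] e by simp
    moreover have "eventually (\<lambda>n. Q n (e / 2)) sequentially"
      using e by (intro ev) simp
    ultimately show "eventually (\<lambda>n. dist (\<epsilon> n) 0 < e) sequentially"
    proof eventually_elim
      case (elim n)
      have mem: "e / 2 \<in> A n" using elim e by (simp add: A_def)
      then have "Inf (A n) \<le> e / 2" by (rule cInf_lower[OF _ bdd])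
      moreover have "0 \<le> Inf (A n)"
        by (rule cInf_greatest) (use mem in \<open>blast\<close>, simp add: A_def)
      moreover have "0 < inverse (real (Suc n))" by simp
      ultimately have "0 \<le> \<epsilon> n" "\<epsilon> n < e"
        using elim(1) unfolding \<epsilon>_def by linarith+
      then show ?case by simp
    qed
  qed
  have "eventually (\<lambda>n. Q n 1) sequentially" by (intro ev) simp
  then show "eventually (\<lambda>n. Q n (\<epsilon> n)) sequentially"
  proof eventually_elim
    case (elim n)
    then have "A n \<noteq> {}" by (auto simp: A_def intro!: exI[of _ 1])
    moreover have "Inf (A n) < \<epsilon> n" by (simp add: \<epsilon>_def)
    ultimately obtain d where "d \<in> A n" "d < \<epsilon> n"
      by (meson cInf_lessD)
    then show ?case using mono[of n d] by (simp add: A_def)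
  qed
qed

text \<open>
  The lower bound only needs one fixed \<open>u\<close> at a time in the supremum. For the upper bound at \<open>x\<close>, take a
  nearby subgradient \<open>y0\<close> of \<open>hq - E0\<close> at some \<open>u\<close> with almost the same value; subgradients \<open>y n\<close> of \<open>hq - E n\<close> at
  the same \<open>u\<close> tend to \<open>y0\<close>, and \<open>deconv (E n) (y n) = E n u - hq (y n - u)\<close> tends to \<open>deconv E0 y0\<close>.
  A diagonal choice then removes the tolerance.
\<close>

lemma epi_converges_deconv:
  fixes f :: "nat \<Rightarrow> 'a::euclidean_space \<Rightarrow> ereal"
  assumes f: "\<And>n x. f n x \<noteq> -\<infinity>" "eventually (\<lambda>n. f n = deconv (E n)) sequentially"
    and E: "\<And>n. E n \<in> env_class" and E0: "E0 \<in> env_class"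
    and lim: "\<And>x. (\<lambda>n. E n x) \<longlonglongrightarrow> E0 x"
  shows "epi_converges f (deconv E0)"
  unfolding epi_converges_def
proof (intro conjI allI impI)
  show "f n x \<noteq> -\<infinity>" for n x by (rule f(1))
  show D0: "deconv E0 x \<noteq> -\<infinity>" for x
    using deconv_upper[of E0 x x] by auto
  fix x
  show "deconv E0 x \<le> liminf (\<lambda>n. f n (X n))" if X: "X \<longlonglongrightarrow> x" for X
    unfolding deconv_def[of E0]
  proof (rule SUP_least)
    fix u
    have "(\<lambda>n. ereal (E n u - hq (X n - u))) \<longlonglongrightarrow> ereal (E0 u - hq (x - u))"
      unfolding hq_def by (intro tendsto_intros X lim) auto
    then have "ereal (E0 u - hq (x - u)) = liminf (\<lambda>n. ereal (E n u - hq (X n - u)))"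
      by (intro lim_imp_Liminf[symmetric]) auto
    also have "\<dots> \<le> liminf (\<lambda>n. f n (X n))"
      using f(2) by (intro Liminf_mono) (auto elim!: eventually_mono simp: deconv_upper)
    finally show "ereal (E0 u - hq (x - u)) \<le> liminf (\<lambda>n. f n (X n))" .
  qed
  show "\<exists>Y. Y \<longlonglongrightarrow> x \<and> limsup (\<lambda>n. f n (Y n)) \<le> deconv E0 x"
  proof (cases "deconv E0 x")
    case PInf
    then show ?thesis by (intro exI[of _ "\<lambda>_. x"]) simp
  next
    case MInf
    with D0 show ?thesis by simp
  next
    case (real c)
    define Q where "Q n e \<longleftrightarrow> (\<exists>y. dist y x < e \<and> f n y < ereal (c + e))" for n e
    have "eventually (\<lambda>n. Q n e) sequentially" if e: "0 < e" for e
    proof -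
      obtain u y0 where y0: "\<And>v. (hq u - E0 u) + y0 \<bullet> (v - u) \<le> hq v - E0 v"
        "dist y0 x < e / 2" "deconv E0 y0 \<le> ereal (c + e / 2)"
        using deconv_approx_by_subgradient[OF E0 real, of "e / 2"] e by auto
      have "\<exists>a. \<forall>v. (hq u - E n u) + a \<bullet> (v - u) \<le> hq v - E n v" for n
        using E[of n] by (intro convex_on_imp_subgradient[of "\<lambda>v. hq v - E n v"]) (simp add: env_class_def)
      then obtain y where y: "\<And>n v. (hq u - E n u) + y n \<bullet> (v - u) \<le> hq v - E n v"
        by metis
      have ylim: "y \<longlonglongrightarrow> y0"
        by (rule subgradients_tendsto[OF lim E0 y y0(1)])
      have "(\<lambda>n. dist (y n) x) \<longlonglongrightarrow> dist y0 x"
        by (intro tendsto_intros ylim)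
      then have "eventually (\<lambda>n. dist (y n) x < e) sequentially"
        by (rule order_tendstoD(2)) (use y0(2) e in linarith)
      moreover have "(\<lambda>n. E n u - hq (y n - u)) \<longlonglongrightarrow> E0 u - hq (y0 - u)"
        unfolding hq_def by (intro tendsto_intros ylim lim) auto
      then have "eventually (\<lambda>n. E n u - hq (y n - u) < c + e) sequentially"
        using y0(3) e unfolding deconv_eq_of_subgradient[OF y0(1)]
        by (intro order_tendstoD(2)) auto
      ultimately show ?thesis using f(2)
      proof eventually_elim
        case (elim n)
        then show ?case
          unfolding Q_def by (intro exI[of _ "y n"]) (simp add: deconv_eq_of_subgradient[OF y])
      qed
    qed
    moreover have "Q n e" if "Q n d" "d \<le> e" for n d e
    proof -
      from that(1) obtain y where "dist y x < d" "f n y < ereal (c + d)"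
        by (auto simp: Q_def)
      moreover have "ereal (c + d) \<le> ereal (c + e)" using that(2) by simp
      ultimately show ?thesis
        unfolding Q_def using that(2) by (meson order_less_le_trans)
    qed
    ultimately obtain \<epsilon> where \<epsilon>: "\<epsilon> \<longlonglongrightarrow> 0" "eventually (\<lambda>n. Q n (\<epsilon> n)) sequentially"
      using shrinking_radius[of Q] by blast
    have "\<exists>y. Q n (\<epsilon> n) \<longrightarrow> dist y x < \<epsilon> n \<and> f n y < ereal (c + \<epsilon> n)" for n
      by (auto simp: Q_def)
    then obtain Y where Y: "\<And>n. Q n (\<epsilon> n) \<Longrightarrow> dist (Y n) x < \<epsilon> n \<and> f n (Y n) < ereal (c + \<epsilon> n)"
      by metis
    have "(\<lambda>n. dist (Y n) x) \<longlonglongrightarrow> 0"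
    proof (rule tendsto_sandwich[OF _ _ tendsto_const \<epsilon>(1)])
      show "eventually (\<lambda>n. dist (Y n) x \<le> \<epsilon> n) sequentially"
        using \<epsilon>(2) by eventually_elim (use Y in force)
    qed simp
    then have "Y \<longlonglongrightarrow> x" using tendsto_dist_iff by blast
    moreover have "limsup (\<lambda>n. f n (Y n)) \<le> ereal c"
    proof -
      have "limsup (\<lambda>n. f n (Y n)) \<le> limsup (\<lambda>n. ereal (c + \<epsilon> n))"
        using \<epsilon>(2) by (intro Limsup_mono, eventually_elim) (use Y in force)
      also have "(\<lambda>n. ereal (c + \<epsilon> n)) \<longlonglongrightarrow> ereal (c + 0)"
        by (intro tendsto_intros \<epsilon>(1))
      then have "limsup (\<lambda>n. ereal (c + \<epsilon> n)) = ereal (c + 0)"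
        by (intro lim_imp_Limsup) auto
      finally show ?thesis by simp
    qed
    ultimately show ?thesis using real by auto
  qed
qed

section \<open>Linear recurrences whose roots lie in the unit disc\<close>

text \<open>
  The polynomial \<open>p\<close> evaluated at the shift operator, applied to the sequence \<open>s\<close>.
\<close>

definition shift_poly :: "'a::comm_ring_1 poly \<Rightarrow> (nat \<Rightarrow> 'a) \<Rightarrow> nat \<Rightarrow> 'a" where
  "shift_poly p s n = (\<Sum>i\<le>degree p. coeff p i * s (n + i))"

lemma shift_poly_altdef:
  assumes "degree p \<le> N"
  shows "shift_poly p s n = (\<Sum>i\<le>N. coeff p i * s (n + i))"
  unfolding shift_poly_def using assms
  by (intro sum.mono_neutral_left) (auto simp: coeff_eq_0)

lemma shift_poly_linear_factor:
  "shift_poly ([:- z, 1:] * q) s n = shift_poly q s (Suc n) - z * shift_poly q s n"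
proof -
  let ?N = "degree q"
  have prod: "[:- z, 1:] * q = pCons 0 q - smult z q" by simp
  have "degree ([:- z, 1:] * q) \<le> Suc ?N"
    using degree_mult_le[of "[:- z, 1:]" q] by simp
  then have "shift_poly ([:- z, 1:] * q) s n = (\<Sum>i\<le>Suc ?N. coeff ([:- z, 1:] * q) i * s (n + i))"
    by (rule shift_poly_altdef)
  also have "\<dots>
      = (\<Sum>i\<le>Suc ?N. coeff (pCons 0 q) i * s (n + i)) - (\<Sum>i\<le>Suc ?N. coeff (smult z q) i * s (n + i))"
    unfolding prod coeff_diff left_diff_distrib sum_subtractf ..
  also have "(\<Sum>i\<le>Suc ?N. coeff (pCons 0 q) i * s (n + i)) = shift_poly q s (Suc n)"
    by (simp only: sum.atMost_Suc_shift) (simp add: shift_poly_def)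
  also have "(\<Sum>i\<le>Suc ?N. coeff (smult z q) i * s (n + i)) = z * shift_poly q s n"
    by (simp add: shift_poly_def sum_distrib_left mult.assoc coeff_eq_0)
  finally show ?thesis .
qed

lemma shift_poly_const: "shift_poly p (\<lambda>_. c) n = poly p 1 * c"
  by (simp add: shift_poly_def poly_altdef sum_distrib_right)

lemma shift_poly_diff: "shift_poly p (\<lambda>n. s n - t n) n = shift_poly p s n - shift_poly p t n"
  by (simp add: shift_poly_def right_diff_distrib sum_subtractf)

text \<open>
  Inverting a single linear factor: iterating the estimate \<open>\<bar>t\<^bsub>n+1\<^esub>\<bar> \<le> \<bar>z\<bar> \<bar>t\<^sub>n\<bar> + d\<close> from an index on, the initial
  value is damped geometrically and the errors add up to at most \<open>d / (1 - \<bar>z\<bar>)\<close>.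
\<close>

lemma tendsto_0_contraction:
  fixes t :: "nat \<Rightarrow> complex"
  assumes z: "norm z < 1" and v: "(\<lambda>n. t (Suc n) - z * t n) \<longlonglongrightarrow> 0"
  shows "t \<longlonglongrightarrow> 0"
proof (rule LIMSEQ_I)
  fix e :: real assume e: "0 < e"
  define \<rho> where "\<rho> = norm z"
  have \<rho>: "0 \<le> \<rho>" "\<rho> < 1" using z by (auto simp: \<rho>_def)
  (* With this d the geometric series of the errors sums to e / 2. *)
  define d where "d = e / 2 * (1 - \<rho>)"
  have "0 < d" using e \<rho> by (simp add: d_def)
  from LIMSEQ_D[OF v this] obtain N where N: "\<And>n. N \<le> n \<Longrightarrow> norm (t (Suc n) - z * t n) < d"
    by auto
  have bound: "norm (t (N + k)) \<le> \<rho> ^ k * norm (t N) + e / 2" for k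
  proof (induction k)
    case (Suc k)
    have "norm (t (N + Suc k)) \<le> norm (t (Suc (N + k)) - z * t (N + k)) + norm (z * t (N + k))"
      by (metis norm_triangle_ineq add_Suc_right diff_add_cancel)
    also have "\<dots> \<le> d + \<rho> * (\<rho> ^ k * norm (t N) + e / 2)"
      using N[of "N + k"] Suc.IH \<rho> unfolding \<rho>_def norm_mult
      by (intro add_mono mult_left_mono) auto
    also have "\<dots> = \<rho> ^ Suc k * norm (t N) + e / 2"
      by (simp add: d_def field_simps)
    finally show ?case .
  qed (use e in simp)
  have "(\<lambda>k. \<rho> ^ k * norm (t N)) \<longlonglongrightarrow> 0"
    using \<rho> by (auto intro!: tendsto_eq_intros LIMSEQ_realpow_zero)
  from LIMSEQ_D[OF this, of "e / 2"] e
  obtain K where K: "\<And>k. K \<le> k \<Longrightarrow> \<rho> ^ k * norm (t N) < e / 2"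
    using \<rho> by (auto simp: abs_mult)
  show "\<exists>no. \<forall>n\<ge>no. norm (t n - 0) < e"
  proof (intro exI[of _ "N + K"] allI impI)
    fix n assume "N + K \<le> n"
    then have "norm (t n) \<le> \<rho> ^ (n - N) * norm (t N) + e / 2" "\<rho> ^ (n - N) * norm (t N) < e / 2"
      using bound[of "n - N"] K[of "n - N"] by simp_all
    then show "norm (t n - 0) < e" by simp
  qed
qed

text \<open>
  The polynomial splits over the complex numbers, and its linear factors are inverted one after the other.
\<close>

lemma tendsto_0_shift_poly:
  fixes s :: "nat \<Rightarrow> complex"
  assumes "r \<noteq> 0" "\<And>z. poly r z = 0 \<Longrightarrow> norm z < 1" "(\<lambda>n. shift_poly r s n) \<longlonglongrightarrow> 0"
  shows "s \<longlonglongrightarrow> 0"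
  using assms
proof (induction "degree r" arbitrary: r)
  case 0
  then obtain c where c: "r = [:c:]" by (metis degree_eq_zeroE)
  with 0 have "c \<noteq> 0" "(\<lambda>n. c * s n) \<longlonglongrightarrow> 0"
    by (auto simp: shift_poly_def)
  then have "(\<lambda>n. inverse c * (c * s n)) \<longlonglongrightarrow> inverse c * 0"
    by (intro tendsto_intros)
  with \<open>c \<noteq> 0\<close> show ?case by (simp add: mult.assoc[symmetric])
next
  case (Suc k)
  then have "\<not> constant (poly r)" by (simp add: constant_degree)
  then obtain z where z: "poly r z = 0" using fundamental_theorem_of_algebra by blast
  then obtain q where q: "r = [:- z, 1:] * q" by (metis dvdE poly_eq_0_iff_dvd)
  with Suc.prems have "q \<noteq> 0" by auto
  then have "degree r = Suc (degree q)" unfolding q by (subst degree_mult_eq) auto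
  moreover have "(\<lambda>n. shift_poly q s n) \<longlonglongrightarrow> 0"
    using tendsto_0_contraction[OF Suc.prems(2)[OF z]] Suc.prems(3)
    unfolding q shift_poly_linear_factor by blast
  moreover have "norm w < 1" if "poly q w = 0" for w
    using Suc.prems(2)[of w] that by (simp add: q)
  ultimately show ?case using Suc.hyps(1)[of q] Suc.hyps(2) \<open>q \<noteq> 0\<close> by auto
qed

text \<open>
  Simplicity of the root \<open>1\<close> is what makes the cofactor \<open>r\<close> nonzero there.
\<close>

lemma basic_hypothesis_factor:
  assumes "basic_hypothesis m \<alpha>"
  obtains r where "char_poly m \<alpha> = [:- 1, 1:] * r" "poly r 1 \<noteq> 0"
    "\<And>z::complex. poly (map_poly of_real r) z = 0 \<Longrightarrow> norm z < 1"
proof -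
  let ?p = "char_poly m \<alpha>"
  have ord: "order 1 ?p = 1"
    and roots: "\<And>z::complex. poly (map_poly of_real ?p) z = 0 \<Longrightarrow> z \<noteq> 1 \<Longrightarrow> norm z < 1"
    using assms by (auto simp: basic_hypothesis_def)
  have "?p \<noteq> 0"
  proof
    assume "?p = 0"
    then have "poly ?p 2 = 0" by simp
    moreover have "poly ?p 2 = 0 \<longleftrightarrow> (2::real) = 1"
      using assms unfolding basic_hypothesis_def by (meson zero_less_numeral)
    ultimately show False by simp
  qed
  then obtain r where r: "?p = [:- 1, 1:] ^ 1 * r" "\<not> [:- 1, 1:] dvd r"
    using order_decomp[of ?p 1] ord by auto
  have p: "?p = [:- 1, 1:] * r" using r(1) by simp
  have r1: "poly r 1 \<noteq> 0" using r(2) by (simp add: poly_eq_0_iff_dvd)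
  have "?p = pCons 0 r - r" using p by simp
  then have "map_poly of_real ?p = pCons 0 (map_poly of_real r) - (map_poly of_real r :: complex poly)"
    by (intro poly_eqI) (auto simp: coeff_map_poly coeff_pCons split: nat.splits)
  then have mult: "poly (map_poly of_real ?p) z = (z - 1) * poly (map_poly of_real r) z" for z :: complex
    by (simp only: poly_diff poly_pCons) (simp add: algebra_simps)
  have "poly (map_poly of_real r) (1::complex) = of_real (poly r 1)"
    by (simp add: poly_altdef degree_map_poly coeff_map_poly)
  with r1 have "poly (map_poly of_real r) (1::complex) \<noteq> 0" by simp
  then have "norm z < 1" if "poly (map_poly of_real r) z = 0" for z :: complex
    using roots[of z] mult[of z] that by auto
  with p r1 that show thesis by blast
qed

lemma shift_poly_char_poly:
  "shift_poly (char_poly m \<alpha>) x n = x (n + m) - (\<Sum>i<m. \<alpha> i * x (n + i))"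
proof -
  have coeff: "coeff (char_poly m \<alpha>) i = (if i = m then 1 else 0) - (if i < m then \<alpha> i else 0)" for i
  proof -
    have "coeff (\<Sum>i<m. monom (\<alpha> i) i) i = (\<Sum>j<m. if j = i then \<alpha> j else 0)"
      by (simp add: coeff_sum)
    then show ?thesis by (auto simp: char_poly_def)
  qed
  then have "degree (char_poly m \<alpha>) \<le> m"
    by (intro degree_le) auto
  then have "shift_poly (char_poly m \<alpha>) x n
      = (\<Sum>i\<le>m. ((if i = m then 1 else 0) - (if i < m then \<alpha> i else 0)) * x (n + i))"
    by (simp add: shift_poly_altdef coeff)
  also have "{..m} = insert m {..<m}" by auto
  finally show ?thesis by (simp add: sum_negf)
qed

text \<open>
  With the characteristic polynomial \<open>(X - 1) r\<close>, the sequence \<open>r(S) x\<close> (\<open>S\<close> the shift) is constant. Subtracting from \<open>x\<close>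
  the constant \<open>L\<close> with \<open>r(1) L\<close> equal to this value leaves a solution of \<open>r(S) y = 0\<close>, which tends to zero.
\<close>

lemma recurrence_convergent:
  fixes x :: "nat \<Rightarrow> real"
  assumes bh: "basic_hypothesis m \<alpha>"
    and rec: "\<And>n. x (n + m) = (\<Sum>i<m. \<alpha> i * x (n + i))"
  shows "convergent x"
proof -
  obtain r where r: "char_poly m \<alpha> = [:- 1, 1:] * r" "poly r 1 \<noteq> 0"
    "\<And>z::complex. poly (map_poly of_real r) z = 0 \<Longrightarrow> norm z < 1"
    using basic_hypothesis_factor[OF bh] by blast
  have step: "shift_poly r x (Suc n) = shift_poly r x n" for n
    using shift_poly_char_poly[of m \<alpha> x n] rec[of n] shift_poly_linear_factor[of 1 r x n]
    by (simp add: r(1))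
  have const: "shift_poly r x n = shift_poly r x 0" for n
    by (induction n) (simp_all add: step)
  define L where "L = shift_poly r x 0 / poly r 1"
  have zero: "shift_poly r (\<lambda>n. x n - L) n = 0" for n
    unfolding shift_poly_diff shift_poly_const const[of n] using r(2) by (simp add: L_def)
  have "shift_poly (map_poly of_real r) (\<lambda>n. complex_of_real (x n - L)) n
      = of_real (shift_poly r (\<lambda>n. x n - L) n)" for n
    by (simp add: shift_poly_def degree_map_poly coeff_map_poly)
  then have "(\<lambda>n. shift_poly (map_poly of_real r) (\<lambda>n. complex_of_real (x n - L)) n) \<longlonglongrightarrow> 0"
    unfolding zero by simp
  moreover have "map_poly of_real r \<noteq> (0 :: complex poly)"
    using r(2) by (auto simp: map_poly_eq_0_iff)
  ultimately have "(\<lambda>n. complex_of_real (x n - L)) \<longlonglongrightarrow> 0"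
    using tendsto_0_shift_poly[OF _ r(3), where s = "\<lambda>n. complex_of_real (x n - L)"] by blast
  then have "(\<lambda>n. x n - L) \<longlonglongrightarrow> 0"
    using tendsto_of_real_iff[of "\<lambda>n. x n - L" 0 sequentially, where ?'a = complex] by simp
  then show ?thesis
    using LIM_zero_iff convergentI by blast
qed

text \<open>
  Summation by parts: passing from \<open>n\<close> to \<open>n + 1\<close> changes the left-hand side by
  \<open>x\<^bsub>n+m\<^esub> - \<Sum>\<^sub>i \<alpha>\<^sub>i x\<^bsub>n+i\<^esub>\<close>, because the partial sums of \<open>\<alpha>\<close> have differences \<open>\<alpha>\<^sub>i\<close> and end at \<open>1\<close>.
\<close>

lemma recurrence_invariant:
  fixes x :: "nat \<Rightarrow> real"
  assumes m: "m \<ge> 1" and sum: "(\<Sum>i<m. \<alpha> i) = 1"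
    and rec: "\<And>n. x (n + m) = (\<Sum>i<m. \<alpha> i * x (n + i))"
  shows "(\<Sum>k<m. (\<Sum>i\<le>k. \<alpha> i) * x (n + k)) = (\<Sum>k<m. (\<Sum>i\<le>k. \<alpha> i) * x k)"
proof (induction n)
  case (Suc n)
  define A where "A k = (\<Sum>i\<le>k. \<alpha> i)" for k
  obtain l where l: "m = Suc l" using m by (cases m) auto
  have A: "A l = 1" using sum by (simp add: A_def l lessThan_Suc_atMost)
  have "(\<Sum>k<m. A k * x (n + k)) = A 0 * x n + (\<Sum>k<l. A (Suc k) * x (Suc n + k))"
    unfolding l by (subst sum.lessThan_Suc_shift) simp
  moreover have "(\<Sum>i<m. \<alpha> i * x (n + i)) = A 0 * x n + (\<Sum>k<l. \<alpha> (Suc k) * x (Suc n + k))"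
    unfolding l by (subst sum.lessThan_Suc_shift) (simp add: A_def)
  moreover have "(\<Sum>k<m. A k * x (Suc n + k)) = (\<Sum>k<l. A k * x (Suc n + k)) + x (n + m)"
    unfolding l by (simp add: A)
  moreover have "A (Suc k) = A k + \<alpha> (Suc k)" for k by (simp add: A_def)
  ultimately have "(\<Sum>k<m. A k * x (Suc n + k)) = (\<Sum>k<m. A k * x (n + k))"
    using rec[of n] by (simp add: algebra_simps sum.distrib)
  with Suc.IH show ?case by (simp add: A_def)
qed simp

lemma limit_weight_sum:
  assumes m: "m \<ge> 1" and nonneg: "\<And>i. i < m \<Longrightarrow> \<alpha> i \<ge> 0" and sum: "(\<Sum>i<m. \<alpha> i) = 1"
  shows "0 < (\<Sum>j<m. \<Sum>i\<le>j. \<alpha> i)"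
    and "k < m \<Longrightarrow> 0 \<le> limit_weight m \<alpha> k"
    and "(\<Sum>k<m. limit_weight m \<alpha> k) = 1"
proof -
  have nn: "0 \<le> (\<Sum>i\<le>j. \<alpha> i)" if "j < m" for j
    using that by (intro sum_nonneg nonneg) auto
  have "(\<Sum>i\<le>m - 1. \<alpha> i) = 1"
    using m sum by (cases m) (auto simp: lessThan_Suc_atMost)
  moreover have "(\<Sum>i\<le>m - 1. \<alpha> i) \<le> (\<Sum>j<m. \<Sum>i\<le>j. \<alpha> i)"
    using m nn by (intro member_le_sum[of "m - 1" _ "\<lambda>j. \<Sum>i\<le>j. \<alpha> i"]) auto
  ultimately show pos: "0 < (\<Sum>j<m. \<Sum>i\<le>j. \<alpha> i)" by simp
  show "k < m \<Longrightarrow> 0 \<le> limit_weight m \<alpha> k"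
    using pos nn by (simp add: limit_weight_def)
  show "(\<Sum>k<m. limit_weight m \<alpha> k) = 1"
    unfolding limit_weight_def sum_divide_distrib[symmetric] using pos by simp
qed

text \<open>
  The invariant, evaluated in the limit, determines the limit.
\<close>

lemma recurrence_tendsto:
  fixes x :: "nat \<Rightarrow> real"
  assumes bh: "basic_hypothesis m \<alpha>"
    and m: "m \<ge> 1" and nonneg: "\<And>i. i < m \<Longrightarrow> \<alpha> i \<ge> 0" and sum: "(\<Sum>i<m. \<alpha> i) = 1"
    and rec: "\<And>n. x (n + m) = (\<Sum>i<m. \<alpha> i * x (n + i))"
  shows "x \<longlonglongrightarrow> (\<Sum>k<m. limit_weight m \<alpha> k * x k)"
proof -
  obtain L where L: "x \<longlonglongrightarrow> L"
    using recurrence_convergent[OF bh rec] by (auto simp: convergent_def)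
  define A where "A k = (\<Sum>i\<le>k. \<alpha> i)" for k
  have "(\<lambda>n. \<Sum>k<m. A k * x (n + k)) \<longlonglongrightarrow> (\<Sum>k<m. A k * L)"
    by (intro tendsto_intros LIMSEQ_ignore_initial_segment[OF L])
  then have "(\<Sum>k<m. A k * x k) = (\<Sum>k<m. A k * L)"
    unfolding A_def recurrence_invariant[OF m sum rec] by (simp add: LIMSEQ_const_iff)
  then have "L = (\<Sum>k<m. A k * x k) / (\<Sum>k<m. A k)"
    using limit_weight_sum(1)[OF m nonneg sum]
    unfolding sum_distrib_right[symmetric] A_def by (simp add: nonzero_eq_divide_eq mult.commute)
  also have "\<dots> = (\<Sum>k<m. limit_weight m \<alpha> k * x k)"
    unfolding limit_weight_def A_def sum_divide_distrib[of "\<lambda>k. sum \<alpha> {..k} * x k"] by simp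
  finally show ?thesis using L by simp
qed

section \<open>Iterated proximal averages\<close>

theorem theorem6p3:
  fixes m :: nat
    and \<alpha> :: "nat \<Rightarrow> real"
    and g :: "nat \<Rightarrow> real ^ 'n \<Rightarrow> ereal"
  assumes "m \<ge> 2"
    and "CARD('n) = m"
    and "\<And>i. i < m \<Longrightarrow> \<alpha> i \<ge> 0"
    and "(\<Sum>i<m. \<alpha> i) = 1"
    and "\<And>i. i < m \<Longrightarrow> g i \<in> Gamma_fun"
    and "\<And>n. n \<ge> m \<Longrightarrow> g n = prox_average m \<alpha> (\<lambda>i. g (n - m + i))"
  shows "(\<forall>n. g n \<in> Gamma_fun) \<and>
    (\<forall>n\<ge>m. \<forall>x. moreau_env (g n) x =
        (\<Sum>i<m. ereal (\<alpha> i) * moreau_env (g (n - m + i)) x)) \<and>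
    (basic_hypothesis m \<alpha> \<longrightarrow>
      (let \<gamma> = prox_average m (limit_weight m \<alpha>) g in
        epi_converges g \<gamma> \<and>
        epi_converges (\<lambda>n. fenchel_conj (g n)) (fenchel_conj \<gamma>) \<and>
        fenchel_conj \<gamma> = prox_average m (limit_weight m \<alpha>) (\<lambda>k. fenchel_conj (g k))))"
proof -
  define E where "E n x = real_of_ereal (moreau_env (g n) x)" for n x
  have env: "E n \<in> env_class \<and> (\<forall>x. moreau_env (g n) x = ereal (E n x))" if n: "g n \<in> Gamma_fun" for n
  proof -
    obtain e where e: "e \<in> env_class" "\<And>x. moreau_env (g n) x = ereal (e x)"
      using Gamma_fun_moreau_env[OF n] by blast
    then have "E n = e" by (auto simp: E_def)
    with e show ?thesis by simp
  qed
  (* Stated before membership in Gamma_fun is known for all indices: it is the induction step. *)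
  have step: "g n = deconv (\<lambda>x. \<Sum>i<m. \<alpha> i * E (n - m + i) x) \<and>
      (\<lambda>x. \<Sum>i<m. \<alpha> i * E (n - m + i) x) \<in> env_class"
    if n: "m \<le> n" and prev: "\<And>i. i < m \<Longrightarrow> g (n - m + i) \<in> Gamma_fun" for n
  proof
    show "g n = deconv (\<lambda>x. \<Sum>i<m. \<alpha> i * E (n - m + i) x)"
      unfolding assms(6)[OF n] using env[OF prev] assms(4) by (intro prox_average_eq_deconv) auto
    show "(\<lambda>x. \<Sum>i<m. \<alpha> i * E (n - m + i) x) \<in> env_class"
      using env[OF prev] assms(3,4) by (intro env_class_convex_sum) auto
  qed
  have Gamma: "g n \<in> Gamma_fun" for n
  proof (induction n rule: less_induct)
    case (less n)
    show ?case
    proof (cases "n < m")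
      case False
      then have "g (n - m + i) \<in> Gamma_fun" if "i < m" for i
        using that by (intro less.IH) simp
      with step[of n] False show ?thesis
        using deconv_in_Gamma_fun by fastforce
    qed (rule assms(5))
  qed
  have Ecl: "E n \<in> env_class" and Eenv: "moreau_env (g n) x = ereal (E n x)" for n x
    using env[OF Gamma] by auto
  have rec: "E n x = (\<Sum>i<m. \<alpha> i * E (n - m + i) x)" if "m \<le> n" for n x
    using step[OF that Gamma] Eenv[of n x] by (simp add: moreau_env_deconv)
  have g_eq: "g n = deconv (E n)" if "m \<le> n" for n
  proof -
    have "E n = (\<lambda>x. \<Sum>i<m. \<alpha> i * E (n - m + i) x)" using rec[OF that] by blast
    then show ?thesis using step[OF that Gamma] by metis
  qed
  have ii: "moreau_env (g n) x = (\<Sum>i<m. ereal (\<alpha> i) * moreau_env (g (n - m + i)) x)"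
    if "m \<le> n" for n x
    using rec[OF that, of x] by (simp add: Eenv)
  have iii: "let \<gamma> = prox_average m (limit_weight m \<alpha>) g in
        epi_converges g \<gamma> \<and>
        epi_converges (\<lambda>n. fenchel_conj (g n)) (fenchel_conj \<gamma>) \<and>
        fenchel_conj \<gamma> = prox_average m (limit_weight m \<alpha>) (\<lambda>k. fenchel_conj (g k))"
    if bh: "basic_hypothesis m \<alpha>"
  proof -
    let ?w = "limit_weight m \<alpha>"
    have m: "1 \<le> m" using assms(1) by simp
    note w = limit_weight_sum[OF m assms(3,4)]
    define E0 where "E0 x = (\<Sum>k<m. ?w k * E k x)" for x
    have E0cl: "E0 \<in> env_class"
      unfolding E0_def[abs_def] by (intro env_class_convex_sum Ecl w)
    have lim: "(\<lambda>n. E n x) \<longlonglongrightarrow> E0 x" for x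
      unfolding E0_def
    proof (rule recurrence_tendsto[OF bh m assms(3,4)])
      show "E (n + m) x = (\<Sum>i<m. \<alpha> i * E (n + i) x)" for n
        using rec[of "n + m" x] by simp
    qed
    have \<gamma>: "prox_average m ?w g = deconv E0"
      unfolding E0_def[abs_def] by (intro prox_average_eq_deconv Eenv w)
    have conj_g: "fenchel_conj (g n) = deconv (\<lambda>x. hq x - E n x)" for n
      by (rule fenchel_conj_eq_deconv) (rule Eenv)
    have conj_\<gamma>: "fenchel_conj (deconv E0) = deconv (\<lambda>x. hq x - E0 x)"
      by (rule fenchel_conj_eq_deconv) (rule moreau_env_deconv[OF E0cl])
    have avg: "prox_average m ?w (\<lambda>k. fenchel_conj (g k)) = deconv (\<lambda>x. \<Sum>k<m. ?w k * (hq x - E k x))"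
      unfolding conj_g
      by (intro prox_average_eq_deconv moreau_env_deconv env_class_reflect Ecl w)
    have "(\<Sum>k<m. ?w k * (hq x - E k x)) = (\<Sum>k<m. ?w k) * hq x - E0 x" for x
      unfolding E0_def sum_distrib_right right_diff_distrib sum_subtractf ..
    then have avg': "prox_average m ?w (\<lambda>k. fenchel_conj (g k)) = deconv (\<lambda>x. hq x - E0 x)"
      by (simp only: avg w(3) mult_1)
    have "epi_converges g (deconv E0)"
    proof (rule epi_converges_deconv[OF _ _ Ecl E0cl lim])
      show "g n x \<noteq> -\<infinity>" for n x
        using Gamma[of n] by (simp add: Gamma_fun_def proper_fun_def)
      show "eventually (\<lambda>n. g n = deconv (E n)) sequentially"
        using g_eq by (rule eventually_sequentiallyI)
    qed
    moreover have "epi_converges (\<lambda>n. fenchel_conj (g n)) (deconv (\<lambda>x. hq x - E0 x))"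
    proof (rule epi_converges_deconv[OF _ _ env_class_reflect[OF Ecl] env_class_reflect[OF E0cl]])
      show "fenchel_conj (g n) x \<noteq> -\<infinity>" for n x
        using deconv_upper[of "\<lambda>x. hq x - E n x" x x] unfolding conj_g by auto
      show "eventually (\<lambda>n. fenchel_conj (g n) = deconv (\<lambda>x. hq x - E n x)) sequentially"
        by (simp add: conj_g)
      show "(\<lambda>n. hq x - E n x) \<longlonglongrightarrow> hq x - E0 x" for x
        by (intro tendsto_intros lim)
    qed
    ultimately show ?thesis
      unfolding Let_def \<gamma> conj_\<gamma> avg' by blast
  qed
  show ?thesis using Gamma ii iii by blast
qed

end
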